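(* If $(X,Y)\in\mathcal{W}_n$ then $$\mathrm{Tr}(X^kY^kX^mY^m-Y^kX^kY^mX^m)=0$$ for all integers $k,m\ge1$.
   Context: $\mathbb{H}$ is the division ring of real quaternions and $M_n(\mathbb{H})$ the algebra of $n\times n$ quaternionic matrices. $\mathcal{W}_n$ is the set of all pairs $(A,B)\in M_n(\mathbb{H})\times M_n(\mathbb{H})$ that are simultaneously triangularizable, i.e. for which there is $P\in\mathrm{GL}_n(\mathbb{H})$ such that $PAP^{-1}$ and $PBP^{-1}$ are both upper triangular. The quaternionic trace of $A=[a_{ij}]\in M_n(\mathbb{H})$ is $\mathrm{Tr}(A)=\sum_{i=1}^n(a_{ii}+\overline{a_{ii}})=2\,\mathrm{Re}\left(\sum_i a_{ii}\right)\in\mathbb{R}$. *)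

theory Defs
  imports Complex_Main "Jordan_Normal_Form.Matrix"
begin

section \<open>The division ring of real quaternions\<close>

text \<open>\<open>Quat a b c d\<close> stands for \<open>a + b i + c j + d k\<close>.\<close>

codatatype quat = Quat (qRe: real) (qIm1: real) (qIm2: real) (qIm3: real)

lemma quat_eq_iff:
  "x = y \<longleftrightarrow> qRe x = qRe y \<and> qIm1 x = qIm1 y \<and> qIm2 x = qIm2 y \<and> qIm3 x = qIm3 y"
  by (auto intro: quat.expand)

instantiation quat :: ab_group_add
begin

primcorec zero_quat where
  "qRe 0 = 0"
| "qIm1 0 = 0"
| "qIm2 0 = 0"
| "qIm3 0 = 0"

primcorec plus_quat where
  "qRe (x + y) = qRe x + qRe y"
| "qIm1 (x + y) = qIm1 x + qIm1 y"
| "qIm2 (x + y) = qIm2 x + qIm2 y"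
| "qIm3 (x + y) = qIm3 x + qIm3 y"

primcorec uminus_quat where
  "qRe (- x) = - qRe x"
| "qIm1 (- x) = - qIm1 x"
| "qIm2 (- x) = - qIm2 x"
| "qIm3 (- x) = - qIm3 x"

primcorec minus_quat where
  "qRe (x - y) = qRe x - qRe y"
| "qIm1 (x - y) = qIm1 x - qIm1 y"
| "qIm2 (x - y) = qIm2 x - qIm2 y"
| "qIm3 (x - y) = qIm3 x - qIm3 y"

instance
  by standard (simp_all add: quat_eq_iff)

end

instantiation quat :: ring_1
begin

primcorec one_quat where
  "qRe 1 = 1"
| "qIm1 1 = 0"
| "qIm2 1 = 0"
| "qIm3 1 = 0"

primcorec times_quat where
  "qRe (x * y) = qRe x * qRe y - qIm1 x * qIm1 y - qIm2 x * qIm2 y - qIm3 x * qIm3 y"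
| "qIm1 (x * y) = qRe x * qIm1 y + qIm1 x * qRe y + qIm2 x * qIm3 y - qIm3 x * qIm2 y"
| "qIm2 (x * y) = qRe x * qIm2 y - qIm1 x * qIm3 y + qIm2 x * qRe y + qIm3 x * qIm1 y"
| "qIm3 (x * y) = qRe x * qIm3 y + qIm1 x * qIm2 y - qIm2 x * qIm1 y + qIm3 x * qRe y"

instance
  by standard (simp_all add: quat_eq_iff algebra_simps)

end

lemma quat_units:
  fixes i j k :: quat
  defines "i \<equiv> Quat 0 1 0 0" and "j \<equiv> Quat 0 0 1 0" and "k \<equiv> Quat 0 0 0 1"
  shows "i * i = - 1" "j * j = - 1" "k * k = - 1" "i * j * k = - 1"
  by (simp_all add: quat_eq_iff i_def j_def k_def)

text \<open>The square of the quaternion norm, the denominator of the inverse.\<close>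

definition qnorm2 :: "quat \<Rightarrow> real" where
  "qnorm2 x = (qRe x)\<^sup>2 + (qIm1 x)\<^sup>2 + (qIm2 x)\<^sup>2 + (qIm3 x)\<^sup>2"

lemma qnorm2_eq_0_iff: "qnorm2 x = 0 \<longleftrightarrow> x = 0"
  by (simp add: qnorm2_def quat_eq_iff add_nonneg_eq_0_iff)

instantiation quat :: division_ring
begin

primcorec inverse_quat where
  "qRe (inverse x) = qRe x / qnorm2 x"
| "qIm1 (inverse x) = - qIm1 x / qnorm2 x"
| "qIm2 (inverse x) = - qIm2 x / qnorm2 x"
| "qIm3 (inverse x) = - qIm3 x / qnorm2 x"

definition divide_quat :: "quat \<Rightarrow> quat \<Rightarrow> quat" where
  "divide_quat x y = x * inverse y"

instance
proof
  fix x y :: quat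
  show "x div y = x * inverse y"
    by (rule divide_quat_def)
  show "inverse (0 :: quat) = 0"
    by (simp add: quat_eq_iff)
  assume "x \<noteq> 0"
  then have "qnorm2 x \<noteq> 0"
    by (simp add: qnorm2_eq_0_iff)
  moreover have "qRe x * qRe x + qIm1 x * qIm1 x + qIm2 x * qIm2 x + qIm3 x * qIm3 x = qnorm2 x"
    by (simp add: qnorm2_def power2_eq_square)
  ultimately show "inverse x * x = 1" "x * inverse x = 1"
    by (simp_all add: quat_eq_iff add_divide_distrib [symmetric] diff_divide_distrib [symmetric] mult.commute)
qed

end

text \<open>
  The class \<open>conjugatable_ring\<close> of the matrix library demands a multiplicative conjugation;
  quaternionic conjugation reverses products, so it is introduced separately.
\<close>

primcorec qcnj :: "quat \<Rightarrow> quat" where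
  "qRe (qcnj x) = qRe x"
| "qIm1 (qcnj x) = - qIm1 x"
| "qIm2 (qcnj x) = - qIm2 x"
| "qIm3 (qcnj x) = - qIm3 x"


section \<open>Quaternionic trace and simultaneous triangularizability\<close>

definition qtrace :: "quat mat \<Rightarrow> quat" where
  "qtrace A = (\<Sum>i<dim_row A. A $$ (i, i) + qcnj (A $$ (i, i)))"

text \<open>The trace, formally a quaternion, is real and equals twice the real part of the diagonal sum.\<close>

lemma qtrace_real: "qtrace A = Quat (2 * qRe (\<Sum>i<dim_row A. A $$ (i, i))) 0 0 0"
proof -
  have "(\<Sum>i<n. f i + qcnj (f i)) = Quat (2 * qRe (\<Sum>i<n. f i)) 0 0 0"
    for n :: nat and f :: "nat \<Rightarrow> quat"
    by (induction n) (simp_all add: quat_eq_iff)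
  then show ?thesis
    by (simp add: qtrace_def)
qed

text \<open>In \<open>W\<close> the matrix \<open>Q\<close> is the two-sided inverse of \<open>P\<close>, so \<open>P\<close> ranges over \<open>GL\<^sub>n\<close>.\<close>

definition W :: "nat \<Rightarrow> (quat mat \<times> quat mat) set" where
  "W n = {(A, B). A \<in> carrier_mat n n \<and> B \<in> carrier_mat n n \<and>
     (\<exists>P \<in> carrier_mat n n. \<exists>Q \<in> carrier_mat n n.
        inverts_mat P Q \<and> inverts_mat Q P \<and>
        upper_triangular (P * A * Q) \<and> upper_triangular (P * B * Q))}"

end

theory Submission
  imports Defs
begin

text \<open>
  The quaternionic trace is cyclic, hence invariant under similarity, so \<open>X\<close> and \<open>Y\<close> may be
  taken upper triangular and only their diagonal entries \<open>u, v\<close> matter. A power of \<open>u\<close> has the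
  form \<open>a + b u\<close> with real \<open>a, b\<close>, and likewise for \<open>v\<close>. After a cyclic rotation the two real parts
  therefore differ by a real multiple of the real part of \<open>(a + b u) (u v - v u)\<close>, which vanishes
  since the real part is itself cyclic.
\<close>

lemma qRe_mult_commute: "qRe (x * y) = qRe (y * x)"
  by (simp add: mult.commute)

lemma qRe_sum: "qRe (sum f A) = (\<Sum>i\<in>A. qRe (f i))"
  by (induction A rule: infinite_finite_induct) simp_all

text \<open>Every quaternion is a root of a monic real quadratic polynomial, so its powers stay in
  the real span of \<open>1\<close> and \<open>x\<close>. Real scalars are written as the central
  quaternions \<open>Quat a 0 0 0\<close>.\<close>

lemma quat_power_affine:
  obtains a b where "x ^ k = Quat a 0 0 0 + Quat b 0 0 0 * x"
proof -
  have "\<exists>a b. x ^ k = Quat a 0 0 0 + Quat b 0 0 0 * x"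
  proof (induction k)
    case 0
    have "x ^ 0 = Quat 1 0 0 0 + Quat 0 0 0 0 * x"
      by (simp add: quat_eq_iff)
    then show ?case by blast
  next
    case (Suc k)
    then obtain a b where ab: "x ^ k = Quat a 0 0 0 + Quat b 0 0 0 * x"
      by blast
    \<comment> \<open>\<open>x\<^sup>2 = 2 Re(x) x - |x|\<^sup>2\<close>\<close>
    have "x ^ Suc k = Quat (- b * qnorm2 x) 0 0 0 + Quat (a + 2 * b * qRe x) 0 0 0 * x"
      by (simp add: ab quat_eq_iff qnorm2_def power2_eq_square algebra_simps)
    then show ?case by blast
  qed
  then show thesis using that by blast
qed

lemma qRe_power_alternating:
  "qRe (u ^ k * v ^ l * u ^ m * v ^ n) = qRe (v ^ l * u ^ k * v ^ n * u ^ m)"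
proof -
  obtain a b where k: "u ^ k = Quat a 0 0 0 + Quat b 0 0 0 * u" by (rule quat_power_affine)
  obtain c d where l: "v ^ l = Quat c 0 0 0 + Quat d 0 0 0 * v" by (rule quat_power_affine)
  obtain e f where m: "u ^ m = Quat e 0 0 0 + Quat f 0 0 0 * u" by (rule quat_power_affine)
  obtain g h where n: "v ^ n = Quat g 0 0 0 + Quat h 0 0 0 * v" by (rule quat_power_affine)
  \<comment> \<open>The left side is bilinear and alternating in the two powers of \<open>v\<close>:
    the terms in \<open>r\<close> and \<open>v * r * v\<close> cancel, and the coefficient
    determinant is left.\<close>
  have v_part: "v ^ l * r * v ^ n - v ^ n * r * v ^ l = Quat (c * h - d * g) 0 0 0 * (r * v - v * r)"
    for r
    unfolding l n by (simp add: quat_eq_iff algebra_simps)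
  have u_part: "u ^ m * v - v * u ^ m = Quat f 0 0 0 * (u * v - v * u)"
    unfolding m by (simp add: quat_eq_iff algebra_simps)
  \<comment> \<open>Rotating \<open>v ^ l\<close> to the end makes both words start with
    \<open>u ^ k\<close>; the remainders then differ only by exchanging \<open>v ^ l\<close> and
    \<open>v ^ n\<close>.\<close>
  have "qRe (v ^ l * u ^ k * v ^ n * u ^ m) = qRe (u ^ k * (v ^ n * u ^ m * v ^ l))"
    by (metis mult.assoc qRe_mult_commute)
  then have "qRe (u ^ k * v ^ l * u ^ m * v ^ n) - qRe (v ^ l * u ^ k * v ^ n * u ^ m) =
      qRe (u ^ k * (v ^ l * u ^ m * v ^ n - v ^ n * u ^ m * v ^ l))"
    by (simp only: right_diff_distrib minus_quat.simps mult.assoc)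
  also have "\<dots> = qRe (u ^ k * (Quat (c * h - d * g) 0 0 0 * (Quat f 0 0 0 * (u * v - v * u))))"
    by (simp only: v_part u_part)
  \<comment> \<open>Both \<open>u * v - v * u\<close> and \<open>u * (u * v - v * u)\<close> have
    real part zero, by cyclicity.\<close>
  also have "\<dots> = 0"
    unfolding k by (simp add: algebra_simps)
  finally show ?thesis by simp
qed

lemma qtrace_eq_iff:
  "qtrace A = qtrace B \<longleftrightarrow>
    (\<Sum>i<dim_row A. qRe (A $$ (i, i))) = (\<Sum>i<dim_row B. qRe (B $$ (i, i)))"
  by (simp add: qtrace_real quat_eq_iff qRe_sum)

lemma qtrace_minus:
  assumes "A \<in> carrier_mat n n" "B \<in> carrier_mat n n"
  shows "qtrace (A - B) = qtrace A - qtrace B"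
  using assms by (simp add: qtrace_real quat_eq_iff qRe_sum sum_subtractf algebra_simps)

text \<open>The entries do not commute, but the real parts of their products do, and the trace sees
  only real parts; the usual exchange of the double sum then applies.\<close>

lemma qtrace_mult_commute:
  assumes "A \<in> carrier_mat n m" "B \<in> carrier_mat m n"
  shows "qtrace (A * B) = qtrace (B * A)"
proof -
  have diag: "(\<Sum>i<p. qRe ((C * D) $$ (i, i))) = (\<Sum>i<p. \<Sum>j<q. qRe (C $$ (i, j) * D $$ (j, i)))"
    if "C \<in> carrier_mat p q" "D \<in> carrier_mat q p" for C D p q
    using that
    by (simp add: scalar_prod_def qRe_sum atLeast0LessThan del: times_quat.simps)
  have "(\<Sum>i<n. qRe ((A * B) $$ (i, i))) = (\<Sum>i<n. \<Sum>j<m. qRe (A $$ (i, j) * B $$ (j, i)))"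
    using assms by (rule diag)
  also have "\<dots> = (\<Sum>j<m. \<Sum>i<n. qRe (A $$ (i, j) * B $$ (j, i)))"
    by (rule sum.swap)
  also have "\<dots> = (\<Sum>j<m. \<Sum>i<n. qRe (B $$ (j, i) * A $$ (i, j)))"
    by (simp only: qRe_mult_commute)
  also have "\<dots> = (\<Sum>j<m. qRe ((B * A) $$ (j, j)))"
    using assms by (simp only: diag)
  finally show ?thesis
    using assms by (simp add: qtrace_eq_iff)
qed

lemma qtrace_similar:
  assumes "similar_mat_wit A B P Q"
  shows "qtrace A = qtrace B"
proof -
  define n where "n = dim_row A"
  note D = similar_mat_witD[OF n_def assms]
  have "qtrace A = qtrace (P * (B * Q))"
    using D by (simp add: assoc_mult_mat[of P n n B n Q n])
  also have "\<dots> = qtrace (B * Q * P)"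
    using D by (intro qtrace_mult_commute[of _ n n]) auto
  also have "B * Q * P = B"
    using D by (simp add: assoc_mult_mat[of B n n Q n P n])
  finally show ?thesis .
qed

text \<open>The inner \<open>Q * P\<close> cancels because both similarities share their witnesses.
  This carries a simultaneous similarity over to words in the two matrices.\<close>

lemma similar_mat_wit_mult:
  assumes "similar_mat_wit A A' P Q" "similar_mat_wit B B' P Q"
  shows "similar_mat_wit (A * B) (A' * B') P Q"
proof -
  define n where "n = dim_row A"
  note A = similar_mat_witD[OF n_def assms(1)]
  \<comment> \<open>The common witness \<open>P\<close> forces \<open>A\<close> and \<open>B\<close>
    to have the same size.\<close>
  have "dim_row B = n"
    using similar_mat_witD(6)[OF refl assms(2)] A(6) by auto
  note B = similar_mat_witD[OF this[symmetric] assms(2)]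
  have "A * B = P * A' * Q * (P * (B' * Q))"
    using A B by (simp add: assoc_mult_mat[of P n n B' n Q n])
  also have "\<dots> = P * A' * (Q * (P * (B' * Q)))"
    using A B by (intro assoc_mult_mat[of _ n n _ n _ n]) auto
  also have "Q * (P * (B' * Q)) = B' * Q"
    using A B by (simp add: assoc_mult_mat[of Q n n P n "B' * Q" n, symmetric])
  also have "P * A' * (B' * Q) = P * (A' * (B' * Q))"
    using A B by (intro assoc_mult_mat[of _ n n _ n _ n]) auto
  also have "A' * (B' * Q) = A' * B' * Q"
    using A B by (intro assoc_mult_mat[symmetric, of _ n n _ n _ n]) auto
  also have "P * (A' * B' * Q) = P * (A' * B') * Q"
    using A B by (intro assoc_mult_mat[symmetric, of _ n n _ n _ n]) auto
  finally show ?thesis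
    by (rule similar_mat_witI[OF A(1,2)]) (use A(4-7) B(4-7) in auto)
qed

lemma upper_triangular_mult:
  fixes A B :: "'a :: semiring_0 mat"
  assumes A: "A \<in> carrier_mat n n" "upper_triangular A"
    and B: "B \<in> carrier_mat n n" "upper_triangular B"
  shows "upper_triangular (A * B)"
    and "i < n \<Longrightarrow> (A * B) $$ (i, i) = A $$ (i, i) * B $$ (i, i)"
proof -
  have prod: "(A * B) $$ (i, j) = (\<Sum>l<n. A $$ (i, l) * B $$ (l, j))" if "i < n" "j < n" for i j
    using that A B by (simp add: scalar_prod_def atLeast0LessThan)
  show "upper_triangular (A * B)"
  proof
    fix i j assume ij: "j < i" "i < dim_row (A * B)"
    \<comment> \<open>Either \<open>l < i\<close> and the factor from \<open>A\<close> vanishes, or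
      \<open>j < i \<le> l\<close> and the factor from \<open>B\<close> does.\<close>
    have "A $$ (i, l) * B $$ (l, j) = 0" if "l < n" for l
    proof (cases "l < i")
      case True
      then show ?thesis using ij A by (simp add: upper_triangularD)
    next
      case False
      then show ?thesis using that ij B by (simp add: upper_triangularD)
    qed
    then show "(A * B) $$ (i, j) = 0"
      using ij A prod by simp
  qed
  assume i: "i < n"
  have "(A * B) $$ (i, i) = (\<Sum>l<n. A $$ (i, l) * B $$ (l, i))"
    using i by (simp only: prod)
  also have "\<dots> = (\<Sum>l<n. if l = i then A $$ (i, i) * B $$ (i, i) else 0)"
  proof (rule sum.cong)
    fix l assume "l \<in> {..<n}"
    then show "A $$ (i, l) * B $$ (l, i) = (if l = i then A $$ (i, i) * B $$ (i, i) else 0)"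
      using i A B by (cases l i rule: linorder_cases) (simp_all add: upper_triangularD)
  qed simp
  also have "\<dots> = A $$ (i, i) * B $$ (i, i)"
    using i by simp
  finally show "(A * B) $$ (i, i) = A $$ (i, i) * B $$ (i, i)" .
qed

lemma upper_triangular_pow:
  fixes A :: "'a :: semiring_1 mat"
  assumes A: "A \<in> carrier_mat n n" "upper_triangular A"
  shows "upper_triangular (A ^\<^sub>m k)"
    and "i < n \<Longrightarrow> (A ^\<^sub>m k) $$ (i, i) = (A $$ (i, i)) ^ k"
proof -
  have "upper_triangular (A ^\<^sub>m k) \<and> (\<forall>i<n. (A ^\<^sub>m k) $$ (i, i) = (A $$ (i, i)) ^ k)"
  proof (induction k)
    case 0
    then show ?case using A by simp
  next
    case (Suc k)
    \<comment> \<open>The matrix power appends its new factor on the right, the scalar power on the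
      left; \<open>power_commutes\<close> reconciles them.\<close>
    then show ?case
      using upper_triangular_mult[OF pow_carrier_mat[OF A(1)] _ A, of k]
      by (simp add: power_commutes)
  qed
  then show "upper_triangular (A ^\<^sub>m k)"
    and "i < n \<Longrightarrow> (A ^\<^sub>m k) $$ (i, i) = (A $$ (i, i)) ^ k"
    by auto
qed

theorem corollary6p4:
  fixes n k m :: nat and X Y :: "quat mat"
  assumes "(X, Y) \<in> W n"
    and "k \<ge> 1" and "m \<ge> 1"
  shows "qtrace (X ^\<^sub>m k * Y ^\<^sub>m k * X ^\<^sub>m m * Y ^\<^sub>m m
               - Y ^\<^sub>m k * X ^\<^sub>m k * Y ^\<^sub>m m * X ^\<^sub>m m) = 0"
proof -
  from assms(1) obtain P Q where
    X: "X \<in> carrier_mat n n" and Y: "Y \<in> carrier_mat n n" and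
    P: "P \<in> carrier_mat n n" and Q: "Q \<in> carrier_mat n n" and
    inverts: "inverts_mat P Q" "inverts_mat Q P" and
    triangular: "upper_triangular (P * X * Q)" "upper_triangular (P * Y * Q)"
    unfolding W_def by blast
  have PQ: "P * Q = 1\<^sub>m n" and QP: "Q * P = 1\<^sub>m n"
    using inverts P Q by (simp_all add: inverts_mat_def)
  define U V where "U = P * X * Q" and "V = P * Y * Q"
  have U: "U \<in> carrier_mat n n" "upper_triangular U"
    and V: "V \<in> carrier_mat n n" "upper_triangular V"
    using P Q X Y triangular by (simp_all add: U_def V_def)
  have XU: "similar_mat_wit X U Q P"
    by (rule similar_mat_wit_sym, rule similar_mat_witI[OF PQ QP U_def]) (use P Q X U in simp_all)
  have YV: "similar_mat_wit Y V Q P"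
    by (rule similar_mat_wit_sym, rule similar_mat_witI[OF PQ QP V_def]) (use P Q Y V in simp_all)
  \<comment> \<open>The two products in the claim are \<open>?w X Y\<close> and
    \<open>?w Y X\<close>, so the goal is that exchanging the arguments preserves the trace.\<close>
  let ?w = "\<lambda>A B. A ^\<^sub>m k * B ^\<^sub>m k * A ^\<^sub>m m * B ^\<^sub>m m"
  have triangular_word: "(?w A B) $$ (i, i) =
      (A $$ (i, i)) ^ k * (B $$ (i, i)) ^ k * (A $$ (i, i)) ^ m * (B $$ (i, i)) ^ m"
    if "A \<in> carrier_mat n n" "upper_triangular A" "B \<in> carrier_mat n n" "upper_triangular B"
      and "i < n" for A B :: "quat mat" and i
    using that
    by (simp add: upper_triangular_mult[of _ n] upper_triangular_pow[of _ n]
        mult_carrier_mat[of _ n n _ n] del: index_mult_mat(1))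
  have "qtrace (?w X Y) = qtrace (?w U V)"
    by (intro qtrace_similar[of _ _ Q P] similar_mat_wit_mult similar_mat_wit_pow XU YV)
  \<comment> \<open>On each diagonal entry this is \<open>qRe_power_alternating\<close> with
    exponents \<open>k\<close>, \<open>k\<close>, \<open>m\<close>, \<open>m\<close>.\<close>
  also have "\<dots> = qtrace (?w V U)"
    using U V
    by (simp add: qtrace_eq_iff triangular_word qRe_power_alternating
        del: index_mult_mat(1) times_quat.simps)
  also have "\<dots> = qtrace (?w Y X)"
    by (intro qtrace_similar[symmetric, of _ _ Q P] similar_mat_wit_mult similar_mat_wit_pow XU YV)
  finally show ?thesis
    using X Y by (subst qtrace_minus[of _ n]) auto
qed

end
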